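(* Let $ABC$ be a triangle with incenter $I$, and let the cevians through $I$ be $AD$, $BE$, $CF$, with $D$ on side $BC$, $E$ on side $CA$, $F$ on side $AB$. Let $r_1$ be the radius of the excircle of $\triangle BID$ that touches side $BD$, $r_2$ the radius of the excircle of $\triangle CID$ that touches side $DC$, $r_3$ the radius of the excircle of $\triangle CIE$ that touches side $CE$, $r_4$ the radius of the excircle of $\triangle AIE$ that touches side $EA$, $r_5$ the radius of the excircle of $\triangle AIF$ that touches side $AF$, and $r_6$ the radius of the excircle of $\triangle BIF$ that touches side $FB$. If $\alpha=\frac12\angle BAC$, $\beta=\frac12\angle CBA$, $\gamma=\frac12\angle ACB$, then $$\frac{\cos\gamma}{r_1}+\frac{\cos\alpha}{r_3}+\frac{\cos\beta}{r_5}=\frac{\cos\beta}{r_2}+\frac{\cos\gamma}{r_4}+\frac{\cos\alpha}{r_6}.$$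
   Context: A cevian through a point $P$ inside a triangle is the segment from a vertex through $P$ to the opposite side. The excircle of a triangle that touches a given side is the circle tangent to that side (segment) and to the extensions of the other two sides, lying on the opposite side of that segment from the remaining vertex. *)

theory Defs
  imports "HOL-Analysis.Analysis"
begin

text \<open>The angle \<open>\<angle>PQR\<close> at the vertex \<open>Q\<close>, in radians, between \<open>0\<close> and \<open>pi\<close>.\<close>

definition angle :: "real^2 \<Rightarrow> real^2 \<Rightarrow> real^2 \<Rightarrow> real" where
  "angle P Q R = arccos (((P - Q) \<bullet> (R - Q)) / (norm (P - Q) * norm (R - Q)))"

text \<open>A circle is given by its centre \<open>c\<close> and radius \<open>r\<close>. For \<open>r > 0\<close> and \<open>P \<noteq> Q\<close>, meeting
  the line \<open>PQ\<close> in exactly one point \<open>T\<close> is tangency at \<open>T\<close>.\<close>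

definition tangent_at :: "real^2 \<Rightarrow> real \<Rightarrow> real^2 \<Rightarrow> real^2 \<Rightarrow> real^2 \<Rightarrow> bool" where
  "tangent_at c r P Q T \<longleftrightarrow> sphere c r \<inter> affine hull {P, Q} = {T}"

definition touches_side :: "real^2 \<Rightarrow> real \<Rightarrow> real^2 \<Rightarrow> real^2 \<Rightarrow> bool" where
  "touches_side c r P Q \<longleftrightarrow> (\<exists>T \<in> closed_segment P Q. tangent_at c r P Q T)"

text \<open>Tangency to the extension of \<open>PQ\<close> beyond \<open>Q\<close>; the order of \<open>P\<close> and \<open>Q\<close> matters.\<close>

definition touches_extension :: "real^2 \<Rightarrow> real \<Rightarrow> real^2 \<Rightarrow> real^2 \<Rightarrow> bool" where
  "touches_extension c r P Q \<longleftrightarrow> (\<exists>T. Q \<in> open_segment P T \<and> tangent_at c r P Q T)"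

definition is_incircle :: "real^2 \<Rightarrow> real^2 \<Rightarrow> real^2 \<Rightarrow> real^2 \<Rightarrow> real \<Rightarrow> bool" where
  "is_incircle A B C c r \<longleftrightarrow>
     r > 0 \<and> sphere c r \<subseteq> convex hull {A, B, C} \<and>
     touches_side c r B C \<and> touches_side c r C A \<and> touches_side c r A B"

definition is_incenter :: "real^2 \<Rightarrow> real^2 \<Rightarrow> real^2 \<Rightarrow> real^2 \<Rightarrow> bool" where
  "is_incenter A B C I \<longleftrightarrow> (\<exists>r. is_incircle A B C I r)"

text \<open>The excircle of the triangle \<open>VXY\<close> that touches the side \<open>XY\<close>. The last conjunct says that
  the circle lies on the side of the line \<open>XY\<close> opposite to \<open>V\<close>; the segments are closed because
  the point of tangency lies on that line.\<close>

definition is_excircle :: "real^2 \<Rightarrow> real^2 \<Rightarrow> real^2 \<Rightarrow> real^2 \<Rightarrow> real \<Rightarrow> bool" where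
  "is_excircle V X Y c r \<longleftrightarrow>
     r > 0 \<and> touches_side c r X Y \<and>
     touches_extension c r V X \<and> touches_extension c r V Y \<and>
     (\<forall>Z \<in> sphere c r. closed_segment V Z \<inter> affine hull {X, Y} \<noteq> {})"

definition is_exradius :: "real^2 \<Rightarrow> real^2 \<Rightarrow> real^2 \<Rightarrow> real \<Rightarrow> bool" where
  "is_exradius V X Y r \<longleftrightarrow> (\<exists>c. is_excircle V X Y c r)"

text \<open>\<open>VS\<close> is the cevian from \<open>V\<close> through \<open>P\<close>, ending at \<open>S\<close> on the side \<open>XY\<close>.\<close>

definition is_cevian :: "real^2 \<Rightarrow> real^2 \<Rightarrow> real^2 \<Rightarrow> real^2 \<Rightarrow> real^2 \<Rightarrow> bool" where
  "is_cevian V X Y P S \<longleftrightarrow> S \<in> closed_segment X Y \<and> P \<in> closed_segment V S"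

end

theory Submission
  imports Defs
begin

text \<open>All six small triangles have the inradius \<open>\<rho>\<close> as their height from \<open>I\<close>, so each \<open>r\<close> is read off
  from the side lengths: \<open>r (IB + ID - BD) = \<rho> BD\<close> for the triangle \<open>BID\<close>. By the angle bisector
  theorem \<open>BD = ac / (b + c)\<close> and \<open>ID = a IA / (b + c)\<close>, and since the angle \<open>AIB\<close> is \<open>pi/2 + \<gamma>\<close>, twice the
  area of \<open>AIB\<close> is \<open>IA IB cos \<gamma> = c \<rho>\<close>. Hence
  \<open>cos \<gamma> / r1 = (b + c) / (a IA) + 1 / IB - cos \<gamma> / \<rho>\<close>, and likewise for the other five radii; in the
  sums the terms on the right cancel in pairs.\<close>

section \<open>Tangent lines and tangent lengths\<close>

text \<open>Turns the existence of exactly one common point into perpendicularity of radius and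
  line, from which all later uses of tangency are derived.\<close>

lemma tangent_at_facts:
  assumes "tangent_at c r P Q T"
  shows "(c - T) \<bullet> (Q - P) = 0" "norm (c - T) = r" "\<exists>k. T = P + k *\<^sub>R (Q - P)"
proof -
  have T: "T \<in> sphere c r" "T \<in> affine hull {P, Q}"
    and uniq: "\<And>U. U \<in> sphere c r \<Longrightarrow> U \<in> affine hull {P, Q} \<Longrightarrow> U = T"
    using assms unfolding tangent_at_def by blast+
  show "norm (c - T) = r" using T(1) by (simp add: dist_norm)
  have line: "U \<in> affine hull {P, Q} \<longleftrightarrow> (\<exists>k. U = P + k *\<^sub>R (Q - P))" for U
    by (auto simp: affine_hull_2_alt)
  show ex: "\<exists>k. T = P + k *\<^sub>R (Q - P)" using T(2) line by blast
  then obtain k where k: "T = P + k *\<^sub>R (Q - P)" by blast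
  define m where "m = 2 * ((c - T) \<bullet> (Q - P)) / ((Q - P) \<bullet> (Q - P))"
  \<comment> \<open>the mirror image of \<open>T\<close> in the perpendicular dropped from the centre is a second common point\<close>
  define U where "U = T + m *\<^sub>R (Q - P)"
  have "U = P + (k + m) *\<^sub>R (Q - P)" unfolding U_def by (subst k) (simp add: algebra_simps)
  then have "U \<in> affine hull {P, Q}" using line by blast
  moreover have "U \<in> sphere c r"
  proof -
    have expand: "(w - m *\<^sub>R d) \<bullet> (w - m *\<^sub>R d) = w \<bullet> w - m * (2 * (w \<bullet> d) - m * (d \<bullet> d))"
      for w d :: "real^2"
      by (simp add: inner_diff inner_commute[of d w] algebra_simps)
    \<comment> \<open>For \<open>Q = P\<close> division by zero gives \<open>m = 0\<close>, and both
      sides are 0.\<close>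
    have "m * ((Q - P) \<bullet> (Q - P)) = 2 * ((c - T) \<bullet> (Q - P))"
      by (cases "Q = P") (simp_all add: m_def)
    moreover have "c - U = (c - T) - m *\<^sub>R (Q - P)" by (simp add: U_def)
    ultimately have "(c - U) \<bullet> (c - U) = (c - T) \<bullet> (c - T)"
      by (simp only: expand) simp
    then have "norm (c - U) = norm (c - T)" by (simp add: norm_eq_sqrt_inner)
    then show ?thesis using T(1) by (simp add: dist_norm)
  qed
  ultimately have "U = T" using uniq by blast
  then have "m = 0 \<or> Q = P" by (simp add: U_def)
  then show "(c - T) \<bullet> (Q - P) = 0" by (auto simp: m_def)
qed

lemma tangent_length:
  assumes "tangent_at c r V P T"
  shows "(norm (c - V))\<^sup>2 = (dist V T)\<^sup>2 + r\<^sup>2"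
proof -
  note t = tangent_at_facts[OF assms]
  obtain k where k: "T = V + k *\<^sub>R (P - V)" using t(3) by blast
  have "(c - T) \<bullet> (T - V) = 0" using t(1) by (simp add: k)
  then have "(norm ((c - T) + (T - V)))\<^sup>2 = (norm (c - T))\<^sup>2 + (norm (T - V))\<^sup>2"
    by (intro norm_add_Pythagorean) (simp add: orthogonal_def)
  then show ?thesis using t(2) by (simp add: dist_norm norm_minus_commute)
qed

lemma tangent_at_commute: "tangent_at c r P Q T \<longleftrightarrow> tangent_at c r Q P T"
  by (simp add: tangent_at_def insert_commute)

text \<open>Both squared tangent lengths equal the power of \<open>V\<close> with respect to the
  circle, which does not depend on the line.\<close>

lemma equal_tangents:
  assumes "tangent_at c r V P T" "tangent_at c r V Q U"
  shows "dist V T = dist V U"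
  using tangent_length[OF assms(1)] tangent_length[OF assms(2)]
  by (simp add: power2_eq_iff_nonneg)

text \<open>\<open>T\<close> is the orthogonal projection of \<open>c\<close> to the line, so
  \<open>c\<close> may be replaced by \<open>T\<close> in the inner product;
  \<open>k \<ge> 0\<close> says that \<open>T - V\<close> and \<open>P - V\<close> point the same
  way, which fixes the sign.\<close>

lemma tangent_inner:
  assumes "tangent_at c r V P T" "T = V + k *\<^sub>R (P - V)" "k \<ge> 0"
  shows "(c - V) \<bullet> (P - V) = dist V T * dist V P"
proof -
  have "(c - V) \<bullet> (P - V) = (c - T) \<bullet> (P - V) + (T - V) \<bullet> (P - V)"
    by (metis inner_add_left diff_add_cancel add_diff_eq)
  also have "\<dots> = k * (norm (P - V))\<^sup>2"
    unfolding tangent_at_facts(1)[OF assms(1)] by (simp add: assms(2) power2_norm_eq_inner)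
  also have "\<dots> = dist V T * dist V P"
    using assms(3) by (simp add: assms(2) dist_norm norm_minus_commute power2_eq_square)
  finally show ?thesis .
qed

section \<open>Noncollinear triples in the plane\<close>

text \<open>A nonzero \<open>w\<close> orthogonal to both arms forces their determinant to vanish,
  which is the equality case of Cauchy-Schwarz.\<close>

lemma noncollinear_orthogonal_eq_0:
  fixes V P Q w :: "real^2"
  assumes "\<not> collinear {V, P, Q}" "w \<bullet> (P - V) = 0" "w \<bullet> (Q - V) = 0"
  shows "w = 0"
proof (rule ccontr)
  assume "w \<noteq> 0"
  define p q where "p = P - V" and "q = Q - V"
  have 1: "w$1 * p$1 + w$2 * p$2 = 0" "w$1 * q$1 + w$2 * q$2 = 0"
    using assms(2,3) by (simp_all add: p_def q_def inner_vec_def sum_2)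
  have w: "w$1 \<noteq> 0 \<or> w$2 \<noteq> 0" using \<open>w \<noteq> 0\<close> by (auto simp: vec_eq_iff forall_2)
  have "w$1 * (p$1 * q$2 - p$2 * q$1) = 0" "w$2 * (p$1 * q$2 - p$2 * q$1) = 0"
    using 1 by algebra+
  then have det: "p$1 * q$2 - p$2 * q$1 = 0" using w by auto
  \<comment> \<open>Lagrange's identity: the two sides differ by the square of the
    determinant.\<close>
  have "(p \<bullet> q)\<^sup>2 = (p \<bullet> p) * (q \<bullet> q)"
    using det unfolding inner_vec_def sum_2 inner_real_def by algebra
  then have "(p \<bullet> q)\<^sup>2 = (norm p * norm q)\<^sup>2"
    by (simp add: power_mult_distrib power2_norm_eq_inner)
  then have "\<bar>p \<bullet> q\<bar>\<^sup>2 = (norm p * norm q)\<^sup>2" by simp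
  then have "\<bar>p \<bullet> q\<bar> = norm p * norm q" by (rule power2_eq_imp_eq) simp_all
  then have "collinear {0, p, q}" by (simp add: norm_cauchy_schwarz_equal)
  then have "collinear {P, V, Q}" by (simp add: p_def q_def collinear_3)
  then show False using assms(1) by (simp add: insert_commute)
qed

lemma noncollinear_coeffs:
  fixes V P Q :: "real^2"
  assumes "\<not> collinear {V, P, Q}"
    and "a *\<^sub>R (P - V) + b *\<^sub>R (Q - V) = a' *\<^sub>R (P - V) + b' *\<^sub>R (Q - V)"
  shows "a = a'" "b = b'"
proof -
  have key: "u = 0"
    if "\<not> collinear {V, X, Y}" "u *\<^sub>R (X - V) = v *\<^sub>R (Y - V)" for u v X Y
  proof (rule ccontr)
    assume "u \<noteq> 0"
    then have "X - V = (v / u) *\<^sub>R (Y - V)"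
      using that(2) by (metis divide_inverse_commute scaleR_scaleR
          scaleR_one left_inverse)
    then have "collinear {0, X - V, Y - V}"
      by (metis collinear_lemma insert_commute)
    then have "collinear {X, V, Y}" by (simp add: collinear_3)
    then show False using that(1) by (simp add: insert_commute)
  qed
  have "(a - a') *\<^sub>R (P - V) = (b' - b) *\<^sub>R (Q - V)"
    using assms(2) by (simp add: algebra_simps)
  from key[OF assms(1) this] show "a = a'" by simp
  have "\<not> collinear {V, Q, P}" using assms(1) by (simp add: insert_commute)
  moreover have "(b - b') *\<^sub>R (Q - V) = (a' - a) *\<^sub>R (P - V)"
    using assms(2) by (simp add: algebra_simps)
  ultimately have "b - b' = 0" by (rule key)
  then show "b = b'" by simp
qed

text \<open>Equality would put \<open>V\<close> between \<open>P\<close> and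
  \<open>Q\<close>.\<close>

lemma strict_triangle:
  fixes V P Q :: "real^2"
  assumes "\<not> collinear {V, P, Q}"
  shows "dist P Q < dist V P + dist V Q"
proof -
  have "dist P Q \<noteq> dist P V + dist V Q"
    using assms between_imp_collinear[of P Q V] by (auto simp: between insert_commute)
  then show ?thesis using dist_triangle[of P Q V] by (simp add: dist_commute)
qed

section \<open>Circles touching both arms of an angle\<close>

lemma law_of_cosines:
  fixes V P Q :: "'a::real_inner"
  shows "2 * ((P - V) \<bullet> (Q - V)) = (dist V P)\<^sup>2 + (dist V Q)\<^sup>2 - (dist P Q)\<^sup>2"
  by (simp add: dist_norm power2_norm_eq_inner inner_diff inner_commute)

text \<open>Covers both the incircle and the excircle opposite \<open>V\<close>; \<open>s\<close> is the tangent length from \<open>V\<close>.\<close>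

lemma circle_in_angle:
  fixes V P Q c :: "real^2"
  assumes nc: "\<not> collinear {V, P, Q}"
    and P: "(c - V) \<bullet> (P - V) = s * dist V P"
    and Q: "(c - V) \<bullet> (Q - V) = s * dist V Q"
    and r: "(norm (c - V))\<^sup>2 = s\<^sup>2 + r\<^sup>2"
  defines "u \<equiv> dist V P" and "v \<equiv> dist V Q" and "w \<equiv> dist P Q"
  shows "((u + v)\<^sup>2 - w\<^sup>2) *\<^sub>R (c - V) = (2 * s) *\<^sub>R (v *\<^sub>R (P - V) + u *\<^sub>R (Q - V))"
    and "((u + v)\<^sup>2 - w\<^sup>2) * (norm (c - V))\<^sup>2 = 4 * s\<^sup>2 * u * v"
    and "r\<^sup>2 * ((u + v)\<^sup>2 - w\<^sup>2) = s\<^sup>2 * (w\<^sup>2 - (u - v)\<^sup>2)"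
proof -
  define k where "k = (P - V) \<bullet> (Q - V)"
  have k2: "2 * k = u\<^sup>2 + v\<^sup>2 - w\<^sup>2" unfolding k_def u_def v_def w_def by (rule law_of_cosines)
  have PP: "(P - V) \<bullet> (P - V) = u\<^sup>2" and QQ: "(Q - V) \<bullet> (Q - V) = v\<^sup>2"
    unfolding u_def v_def by (metis power2_norm_eq_inner dist_norm dist_commute)+
  have QP: "(Q - V) \<bullet> (P - V) = k" by (simp add: k_def inner_commute)
  \<comment> \<open>\<open>e\<close> is the difference of the two sides of the first claim; it
    vanishes because it is orthogonal to both arms. The vectors \<open>v *\<^sub>R (P - V)\<close>
    and \<open>u *\<^sub>R (Q - V)\<close> have equal length, so their sum points along the angle
    bisector.\<close>
  define e where "e = ((u + v)\<^sup>2 - w\<^sup>2) *\<^sub>R (c - V) - (2 * s) *\<^sub>R (v *\<^sub>R (P - V) + u *\<^sub>R (Q - V))"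
  have expand: "(k *\<^sub>R x - l *\<^sub>R (m *\<^sub>R y + n *\<^sub>R z)) \<bullet> t
      = k * (x \<bullet> t) - l * (m * (y \<bullet> t) + n * (z \<bullet> t))"
    for k l m n :: real and x y z t :: "real^2"
    by (simp add: inner_diff_left inner_add_left)
  have "e \<bullet> (P - V) = ((u + v)\<^sup>2 - w\<^sup>2) * (s * u) - 2 * s * (v * u\<^sup>2 + u * k)"
    unfolding e_def expand P PP QP
    by (simp add: u_def)
  also have "\<dots> = 0" using k2 by algebra
  finally have e1: "e \<bullet> (P - V) = 0" .
  have "e \<bullet> (Q - V) = ((u + v)\<^sup>2 - w\<^sup>2) * (s * v) - 2 * s * (v * k + u * v\<^sup>2)"
    unfolding e_def expand Q QQ k_def[symmetric]
    by (simp add: v_def)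
  also have "\<dots> = 0" using k2 by algebra
  finally have "e \<bullet> (Q - V) = 0" .
  with e1 have "e = 0" by (rule noncollinear_orthogonal_eq_0[OF nc])
  then show 1: "((u + v)\<^sup>2 - w\<^sup>2) *\<^sub>R (c - V) = (2 * s) *\<^sub>R (v *\<^sub>R (P - V) + u *\<^sub>R (Q - V))"
    by (simp add: e_def)
  \<comment> \<open>The inner product of the vector formula with \<open>c - V\<close> gives the
    distance from \<open>V\<close> to the centre.\<close>
  have "((u + v)\<^sup>2 - w\<^sup>2) * (norm (c - V))\<^sup>2 = (((u + v)\<^sup>2 - w\<^sup>2) *\<^sub>R (c - V)) \<bullet> (c - V)"
    by (simp add: power2_norm_eq_inner)
  also have "\<dots> = 2 * s * (v * ((c - V) \<bullet> (P - V)) + u * ((c - V) \<bullet> (Q - V)))"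
    unfolding 1 inner_scaleR_left inner_add_left inner_commute[of _ "c - V"] inner_scaleR_right inner_add_right ..
  also have "\<dots> = 4 * s\<^sup>2 * u * v"
    unfolding P Q by (simp add: u_def v_def power2_eq_square)
  finally show 2: "((u + v)\<^sup>2 - w\<^sup>2) * (norm (c - V))\<^sup>2 = 4 * s\<^sup>2 * u * v" .
  show "r\<^sup>2 * ((u + v)\<^sup>2 - w\<^sup>2) = s\<^sup>2 * (w\<^sup>2 - (u - v)\<^sup>2)"
    using 2 unfolding r by algebra
qed

section \<open>Excircles: tangent length and radius\<close>

lemma touches_side_commute: "touches_side c r P Q \<longleftrightarrow> touches_side c r Q P"
  by (simp add: touches_side_def tangent_at_commute[of c r P Q] closed_segment_commute[of P Q])

text \<open>The touching point splits \<open>XY\<close> into two parts, which equal the tangents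
  from \<open>X\<close> and from \<open>Y\<close> on the extensions. Hence the two equal tangents
  from \<open>V\<close> add up to the perimeter, and each is the semiperimeter
  \<open>s\<close>.\<close>

lemma excircle_tangent_length:
  assumes "is_excircle V X Y c r" "\<not> collinear {V, X, Y}"
  defines "s \<equiv> (dist V X + dist V Y + dist X Y) / 2"
  shows "(c - V) \<bullet> (X - V) = s * dist V X" "(c - V) \<bullet> (Y - V) = s * dist V Y"
    "(norm (c - V))\<^sup>2 = s\<^sup>2 + r\<^sup>2"
proof -
  obtain T where T: "T \<in> closed_segment X Y" "tangent_at c r X Y T"
    using assms(1) by (auto simp: is_excircle_def touches_side_def)
  obtain T1 where T1: "X \<in> open_segment V T1" "tangent_at c r V X T1"
    using assms(1) by (auto simp: is_excircle_def touches_extension_def)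
  obtain T2 where T2: "Y \<in> open_segment V T2" "tangent_at c r V Y T2"
    using assms(1) by (auto simp: is_excircle_def touches_extension_def)
  have ray: "\<exists>k\<ge>0. U = V + k *\<^sub>R (Z - V)" if "Z \<in> open_segment V U" for U Z :: "real^2"
  proof -
    obtain k where k: "0 < k" "Z = (1 - k) *\<^sub>R V + k *\<^sub>R U"
      using \<open>Z \<in> open_segment V U\<close> by (auto simp: in_segment)
    then have "Z - V = k *\<^sub>R (U - V)" by (simp add: algebra_simps)
    then have "U = V + (1 / k) *\<^sub>R (Z - V)" using k(1) by simp
    then show ?thesis using k(1) by (intro exI[of _ "1/k"]) auto
  qed
  have add: "dist V U = dist V Z + dist Z U" if "Z \<in> open_segment V U" for U Z :: "real^2"
    using that between_mem_segment[of V U Z] by (simp add: between open_segment_def)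
  have 0: "dist X Y = dist X T + dist Y T"
    using T(1) between_mem_segment[of X Y T] by (simp add: between dist_commute)
  have 1: "dist X T = dist X T1"
    using equal_tangents T(2) T1(2) tangent_at_commute by blast
  have 2: "dist Y T = dist Y T2"
    using equal_tangents T(2) T2(2) tangent_at_commute by blast
  have 3: "dist V T1 = dist V T2" using equal_tangents T1(2) T2(2) by blast
  have s1: "dist V T1 = s" and s2: "dist V T2 = s"
    using 0 1 2 3 add[OF T1(1)] add[OF T2(1)] by (simp_all add: s_def)
  show "(c - V) \<bullet> (X - V) = s * dist V X"
    using ray[OF T1(1)] tangent_inner[OF T1(2)] s1 by blast
  show "(c - V) \<bullet> (Y - V) = s * dist V Y"
    using ray[OF T2(1)] tangent_inner[OF T2(2)] s2 by blast
  show "(norm (c - V))\<^sup>2 = s\<^sup>2 + r\<^sup>2" using tangent_length[OF T1(2)] s1 by simp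
qed

text \<open>Both sides are twice the area of \<open>VXY\<close>: \<open>T\<close> is the foot of the
  altitude from \<open>V\<close>, and the area is also \<open>r\<close> times the semiperimeter
  minus \<open>XY\<close>.\<close>

lemma exradius_height:
  assumes ex: "is_exradius V X Y r" and "X \<noteq> Y"
    and T: "T = X + k *\<^sub>R (Y - X)" "(V - T) \<bullet> (Y - X) = 0" "T \<noteq> V"
  shows "r * (dist V X + dist V Y - dist X Y) = dist V T * dist X Y"
proof -
  obtain c where c: "is_excircle V X Y c r" using ex by (auto simp: is_exradius_def)
  then have rpos: "r > 0" by (simp add: is_excircle_def)
  \<comment> \<open>In a degenerate triangle \<open>V - T\<close> would be both parallel and
    orthogonal to \<open>Y - X\<close>, hence zero.\<close>
  have nc: "\<not> collinear {V, X, Y}"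
  proof
    assume "collinear {V, X, Y}"
    then obtain m where "V = m *\<^sub>R X + (1 - m) *\<^sub>R Y"
      using collinear_3_expand[of V Y X] assms(2)
      by (metis collinear_3_expand insert_commute)
    then have "V - T = (1 - m - k) *\<^sub>R (Y - X)" by (simp add: T(1) algebra_simps)
    then have "(V - T) \<bullet> (V - T) = 0" using T(2) by (metis inner_scaleR_right mult_zero_right)
    then show False using T(3) by simp
  qed
  define b e f where "b = dist V X" and "e = dist V Y" and "f = dist X Y"
  have f: "f > 0" using assms(2) by (simp add: f_def)
  have tri: "b + e - f > 0" using strict_triangle[OF nc] by (simp add: b_def e_def f_def)
  have s: "b + e + f \<noteq> 0" using f tri by auto
  have "r\<^sup>2 * ((b + e)\<^sup>2 - f\<^sup>2) = ((b + e + f) / 2)\<^sup>2 * (f\<^sup>2 - (b - e)\<^sup>2)"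
    unfolding b_def e_def f_def
    by (rule circle_in_angle(3)[OF nc excircle_tangent_length[OF c nc]])
  then have "(b + e + f) * (4 * r\<^sup>2 * (b + e - f)) = (b + e + f) * ((b + e + f) * (f\<^sup>2 - (b - e)\<^sup>2))"
    by (simp add: power_divide) algebra
  then have "4 * r\<^sup>2 * (b + e - f) = (b + e + f) * (f\<^sup>2 - (b - e)\<^sup>2)" using s by simp
  \<comment> \<open>by Heron's formula, both sides are 16 times the squared area\<close>
  then have heron: "4 * (r * (b + e - f))\<^sup>2 = 4 * b\<^sup>2 * f\<^sup>2 - (b\<^sup>2 + f\<^sup>2 - e\<^sup>2)\<^sup>2"
    by algebra
  have "(V - X) \<bullet> (Y - X) = (V - T) \<bullet> (Y - X) + (T - X) \<bullet> (Y - X)" by (simp add: inner_diff)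
  moreover have "(Y - X) \<bullet> (Y - X) = f\<^sup>2"
    unfolding f_def by (metis power2_norm_eq_inner dist_norm dist_commute)
  ultimately have ip: "(V - X) \<bullet> (Y - X) = k * f\<^sup>2"
    using T(2) by (simp add: T(1))
  have cosX: "b\<^sup>2 + f\<^sup>2 - e\<^sup>2 = 2 * k * f\<^sup>2"
    using law_of_cosines[of V X Y] ip by (simp add: b_def e_def f_def dist_commute)
  have "(norm ((V - T) + (T - X)))\<^sup>2 = (norm (V - T))\<^sup>2 + (norm (T - X))\<^sup>2"
    using T(2) by (intro norm_add_Pythagorean) (simp add: orthogonal_def T(1))
  then have b2: "b\<^sup>2 = (dist V T)\<^sup>2 + k\<^sup>2 * f\<^sup>2"
    by (simp add: b_def f_def dist_norm T(1) norm_minus_commute power_mult_distrib)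
  \<comment> \<open>Inserting \<open>cosX\<close> and \<open>b2\<close> into Heron's formula
    eliminates \<open>b\<close>, \<open>e\<close> and \<open>k\<close> from the right side; only
    height times base remains.\<close>
  have "(r * (b + e - f))\<^sup>2 = (dist V T * f)\<^sup>2"
    using heron b2 unfolding cosX by algebra
  moreover have "0 \<le> r * (b + e - f)" using rpos tri by simp
  moreover have "0 \<le> dist V T * f" using f by simp
  ultimately show ?thesis
    unfolding b_def e_def f_def using power2_eq_iff_nonneg by blast
qed

section \<open>Symmetry under relabelling of the vertices\<close>

lemma is_incircle_rotate: "is_incircle A B C c r \<longleftrightarrow> is_incircle B C A c r"
  by (auto simp: is_incircle_def insert_commute)

lemma is_incircle_swap: "is_incircle A B C c r \<longleftrightarrow> is_incircle A C B c r"
  using touches_side_commute[of c r A B] touches_side_commute[of c r B C]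
    touches_side_commute[of c r C A]
  by (auto simp: is_incircle_def insert_commute)

lemma is_exradius_swap: "is_exradius V X Y r \<longleftrightarrow> is_exradius V Y X r"
  using touches_side_commute[of _ r X Y]
  by (auto simp: is_exradius_def is_excircle_def insert_commute)

lemma is_cevian_swap: "is_cevian V X Y P S \<longleftrightarrow> is_cevian V Y X P S"
  by (simp add: is_cevian_def closed_segment_commute)

lemma angle_swap: "angle P Q R = angle R Q P"
  by (simp add: angle_def inner_commute mult.commute)

section \<open>The incircle and the position of the incenter\<close>

text \<open>Each side is the sum of the tangent lengths from its two ends; solving these three
  equations gives \<open>x\<close>.\<close>

lemma incircle_tangent_length:
  assumes "is_incircle A B C I \<rho>"
  defines "x \<equiv> (dist C A + dist A B - dist B C) / 2"
  shows "(I - A) \<bullet> (B - A) = x * dist A B" "(I - A) \<bullet> (C - A) = x * dist A C"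
    "(norm (I - A))\<^sup>2 = x\<^sup>2 + \<rho>\<^sup>2"
proof -
  obtain T where T: "T \<in> closed_segment B C" "tangent_at I \<rho> B C T"
    using assms(1) by (auto simp: is_incircle_def touches_side_def)
  obtain U where U: "U \<in> closed_segment A C" "tangent_at I \<rho> A C U"
    using assms(1) touches_side_commute[of I \<rho> C A]
    by (auto simp: is_incircle_def touches_side_def)
  obtain W where W: "W \<in> closed_segment A B" "tangent_at I \<rho> A B W"
    using assms(1) by (auto simp: is_incircle_def touches_side_def)
  have ray: "\<exists>k\<ge>0. Z = A + k *\<^sub>R (Y - A)" if Z: "Z \<in> closed_segment A Y" for Y Z :: "real^2"
  proof -
    obtain k where "0 \<le> k" "Z = (1 - k) *\<^sub>R A + k *\<^sub>R Y" using Z by (auto simp: in_segment)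
    then show ?thesis by (intro exI[of _ k]) (simp add: algebra_simps)
  qed
  have add: "dist X Y = dist X Z + dist Y Z" if "Z \<in> closed_segment X Y" for X Y Z :: "real^2"
    using that between_mem_segment[of X Y Z] by (simp add: between dist_commute)
  have 1: "dist B T = dist B W"
    using equal_tangents T(2) W(2) tangent_at_commute by blast
  have 2: "dist C T = dist C U"
    using equal_tangents T(2) U(2) tangent_at_commute by blast
  have 3: "dist A U = dist A W" using equal_tangents U(2) W(2) by blast
  have x: "dist A W = x" "dist A U = x"
    using 1 2 3 add[OF T(1)] add[OF U(1)] add[OF W(1)]
    by (simp_all add: x_def dist_commute[of C A])
  show "(I - A) \<bullet> (B - A) = x * dist A B"
    using ray[OF W(1)] tangent_inner[OF W(2)] x(1) by blast
  show "(I - A) \<bullet> (C - A) = x * dist A C"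
    using ray[OF U(1)] tangent_inner[OF U(2)] x(2) by blast
  show "(norm (I - A))\<^sup>2 = x\<^sup>2 + \<rho>\<^sup>2" using tangent_length[OF W(2)] x(1) by simp
qed

text \<open>The incenter has barycentric coordinates \<open>a : b : c\<close>. All this is
  \<open>circle_in_angle\<close> with tangent length \<open>(b + c - a) / 2\<close>, after
  cancelling the factor \<open>b + c - a\<close>, positive by the strict triangle
  inequality.\<close>

lemma incenter_from_vertex:
  assumes nc: "\<not> collinear {A, B, C}" and inc: "is_incircle A B C I \<rho>"
  defines "a \<equiv> dist B C" and "b \<equiv> dist C A" and "c \<equiv> dist A B"
  shows "(a + b + c) *\<^sub>R (I - A) = b *\<^sub>R (B - A) + c *\<^sub>R (C - A)"
    and "(a + b + c) * (dist I A)\<^sup>2 = (b + c - a) * b * c"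
    and "(dist I A)\<^sup>2 = ((b + c - a) / 2)\<^sup>2 + \<rho>\<^sup>2"
proof -
  have tri: "b + c - a > 0" using strict_triangle[OF nc] by (simp add: a_def b_def c_def dist_commute)
  note t = incircle_tangent_length[OF inc, folded a_def b_def c_def]
  note circ = circle_in_angle[OF nc t[unfolded c_def], folded a_def c_def]
  have sq: "(c + b)\<^sup>2 - a\<^sup>2 = (b + c - a) * (a + b + c)" by algebra
  have two: "2 * ((b + c - a) / 2) = b + c - a" by simp
  have bAC: "dist A C = b" by (simp add: b_def dist_commute)
  have "(b + c - a) *\<^sub>R ((a + b + c) *\<^sub>R (I - A))
      = (b + c - a) *\<^sub>R (b *\<^sub>R (B - A) + c *\<^sub>R (C - A))"
    using circ(1) unfolding bAC sq two by (simp only: scaleR_scaleR)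
  then show "(a + b + c) *\<^sub>R (I - A) = b *\<^sub>R (B - A) + c *\<^sub>R (C - A)"
    using tri by (simp only: real_vector.scale_cancel_left) simp
  have "(b + c - a) * ((a + b + c) * (dist I A)\<^sup>2) = (b + c - a) * ((b + c - a) * b * c)"
    using circ(2) unfolding bAC sq dist_norm[of I A] by (simp add: power_divide) algebra
  then show "(a + b + c) * (dist I A)\<^sup>2 = (b + c - a) * b * c" using tri by simp
  show "(dist I A)\<^sup>2 = ((b + c - a) / 2)\<^sup>2 + \<rho>\<^sup>2" using t(3) by (simp add: dist_norm)
qed

section \<open>Cosines of the half angles and the area of \<open>AIB\<close>\<close>

text \<open>The law of cosines combined with the double angle formula. The sign is recorded because
  the cosine is later recovered from its square.\<close>

lemma cos_half_angle:
  assumes "P \<noteq> Q" "R \<noteq> Q"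
  shows "4 * dist Q P * dist Q R * (cos (angle P Q R / 2))\<^sup>2 = (dist Q P + dist Q R)\<^sup>2 - (dist P R)\<^sup>2"
    and "cos (angle P Q R / 2) \<ge> 0"
proof -
  define k where "k = ((P - Q) \<bullet> (R - Q)) / (norm (P - Q) * norm (R - Q))"
  have le: "\<bar>k\<bar> \<le> 1"
    unfolding k_def abs_divide using Cauchy_Schwarz_ineq2[of "P - Q" "R - Q"] assms
    by (simp add: abs_mult)
  have ang: "angle P Q R = arccos k" by (simp add: angle_def k_def)
  have "cos (angle P Q R) = k" unfolding ang using le by (simp add: cos_arccos_abs)
  moreover have "cos (angle P Q R) = 2 * (cos (angle P Q R / 2))\<^sup>2 - 1"
    using cos_double_cos[of "angle P Q R / 2"] by simp
  ultimately have "2 * (cos (angle P Q R / 2))\<^sup>2 = 1 + k" by simp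
  moreover have "k * (dist Q P * dist Q R) = (P - Q) \<bullet> (R - Q)"
    using assms by (simp add: k_def dist_norm norm_minus_commute)
  ultimately show "4 * dist Q P * dist Q R * (cos (angle P Q R / 2))\<^sup>2
      = (dist Q P + dist Q R)\<^sup>2 - (dist P R)\<^sup>2"
    using law_of_cosines[of P Q R] by algebra
  have "0 \<le> angle P Q R" "angle P Q R \<le> pi"
    unfolding ang using le by (auto intro: arccos_lbound arccos_ubound simp: abs_le_iff)
  then show "cos (angle P Q R / 2) \<ge> 0" by (intro cos_ge_zero) auto
qed

text \<open>In the right triangle formed by \<open>A\<close>, \<open>I\<close> and a touching point,
  this is the leg at \<open>A\<close>. The proof compares squares of side-length expressions, so it
  needs no separate argument that \<open>AI\<close> bisects the angle.\<close>

lemma dist_incenter_cos: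
  assumes nc: "\<not> collinear {A, B, C}" and inc: "is_incircle A B C I \<rho>"
  shows "dist I A * cos (angle B A C / 2) = (dist C A + dist A B - dist B C) / 2"
proof -
  define a b c where "a = dist B C" and "b = dist C A" and "c = dist A B"
  define k where "k = cos (angle B A C / 2)"
  have ne: "B \<noteq> A" "C \<noteq> A" using nc by (auto simp: insert_commute)
  have pos: "b > 0" "c > 0" using ne by (simp_all add: b_def c_def)
  have tri: "b + c - a > 0" using strict_triangle[OF nc] by (simp add: a_def b_def c_def dist_commute)
  have S: "a + b + c > 0" using pos by (simp add: a_def add_nonneg_pos)
  have k: "4 * c * b * k\<^sup>2 = (c + b)\<^sup>2 - a\<^sup>2" "k \<ge> 0"
    using cos_half_angle[OF ne] by (simp_all add: a_def b_def c_def k_def dist_commute)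
  have p: "(a + b + c) * (dist I A)\<^sup>2 = (b + c - a) * b * c"
    using incenter_from_vertex(2)[OF nc inc] by (simp add: a_def b_def c_def)
  have "((a + b + c) * (4 * b * c)) * (dist I A * k)\<^sup>2
      = ((a + b + c) * (4 * b * c)) * ((b + c - a) / 2)\<^sup>2"
    using k(1) p by (simp add: power_divide) algebra
  then have "(dist I A * k)\<^sup>2 = ((b + c - a) / 2)\<^sup>2" using S pos by simp
  then have "dist I A * k = (b + c - a) / 2"
    by (rule power2_eq_imp_eq) (use k(2) tri in simp_all)
  then show ?thesis by (simp add: a_def b_def c_def k_def)
qed

text \<open>Both sides are twice the area of \<open>AIB\<close>. The angle at \<open>I\<close> is
  avoided: everything is expressed by the tangent lengths \<open>x\<close>, \<open>y\<close>,
  \<open>z\<close> from \<open>A\<close>, \<open>B\<close>, \<open>C\<close>.\<close>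

lemma incenter_area:
  assumes nc: "\<not> collinear {A, B, C}" and inc: "is_incircle A B C I \<rho>"
  shows "dist I A * dist I B * cos (angle A C B / 2) = dist A B * \<rho>"
proof -
  define x y z where "x = (dist C A + dist A B - dist B C) / 2"
    and "y = (dist A B + dist B C - dist C A) / 2" and "z = (dist B C + dist C A - dist A B) / 2"
  define p q t where "p = dist I A" and "q = dist I B" and "t = dist I C"
  have sides: "dist B C = y + z" "dist C A = z + x" "dist A B = x + y"
    by (simp_all add: x_def y_def z_def field_simps)
  have nc': "\<not> collinear {B, C, A}" "\<not> collinear {C, A, B}"
    using nc by (simp_all add: insert_commute)
  have inc': "is_incircle B C A I \<rho>" "is_incircle C A B I \<rho>"
    using inc is_incircle_rotate by blast+
  have rpos: "\<rho> > 0" using inc by (simp add: is_incircle_def)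
  have xpos: "x > 0" using strict_triangle[OF nc] by (simp add: x_def dist_commute)
  have ypos: "y > 0" using strict_triangle[OF nc'(1)] by (simp add: y_def dist_commute)
  have zpos: "z > 0" using strict_triangle[OF nc'(2)] by (simp add: z_def dist_commute)
  have P: "(x + y + z) * p\<^sup>2 = x * (z + x) * (x + y)"
    and P': "p\<^sup>2 = x\<^sup>2 + \<rho>\<^sup>2"
    using incenter_from_vertex(2,3)[OF nc inc] unfolding sides p_def[symmetric]
    by (simp_all add: algebra_simps)
  have Q: "(x + y + z) * q\<^sup>2 = y * (x + y) * (y + z)"
    using incenter_from_vertex(2)[OF nc'(1) inc'(1)] unfolding sides q_def[symmetric]
    by (simp add: algebra_simps)
  have T: "(x + y + z) * t\<^sup>2 = z * (y + z) * (z + x)"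
    using incenter_from_vertex(2)[OF nc'(2) inc'(2)] unfolding sides t_def[symmetric]
    by (simp add: algebra_simps)
  have rho: "(x + y + z) * \<rho>\<^sup>2 = x * y * z" using P P' by algebra
  \<comment> \<open>The distances \<open>p\<close>, \<open>q\<close>, \<open>t\<close> are known
    only through their squares, so the identity \<open>p * q * z = (x + y) * \<rho> * t\<close> is
    proved squared. Replacing \<open>z\<close> by \<open>t\<close> times the cosine and cancelling
    \<open>t\<close> then gives the claim.\<close>
  have "(x + y + z)\<^sup>2 * (p * q * z)\<^sup>2 = ((x + y + z) * p\<^sup>2) * ((x + y + z) * q\<^sup>2) * z\<^sup>2"
    by algebra
  also have "\<dots> = (x + y)\<^sup>2 * (x * y * z) * (z * (y + z) * (z + x))"
    unfolding P Q by algebra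
  also have "\<dots> = (x + y + z)\<^sup>2 * ((x + y) * \<rho> * t)\<^sup>2"
    unfolding rho[symmetric] T[symmetric] by algebra
  finally have "(p * q * z)\<^sup>2 = ((x + y) * \<rho> * t)\<^sup>2" using xpos ypos zpos by simp
  then have "p * q * z = (x + y) * \<rho> * t"
    by (rule power2_eq_imp_eq) (use xpos ypos zpos rpos in \<open>simp_all add: p_def q_def t_def\<close>)
  moreover have z: "t * cos (angle A C B / 2) = z"
    using dist_incenter_cos[OF nc'(2) inc'(2)] by (simp add: t_def z_def)
  ultimately have "t * (p * q * cos (angle A C B / 2)) = t * ((x + y) * \<rho>)" by algebra
  moreover have "t \<noteq> 0" using z zpos by auto
  ultimately show ?thesis by (simp add: sides p_def q_def)
qed

section \<open>The foot of a bisector and the radii of the half triangles\<close>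

text \<open>Writing \<open>I - A\<close> in the basis \<open>B - A\<close>, \<open>C - A\<close>
  once through \<open>D\<close> and once by the barycentric formula, and comparing coefficients,
  gives the ratios in which \<open>D\<close> divides \<open>BC\<close> and \<open>I\<close> divides
  \<open>AD\<close>.\<close>

lemma bisector_foot:
  assumes nc: "\<not> collinear {A, B, C}" and inc: "is_incircle A B C I \<rho>"
    and cev: "is_cevian A B C I D"
  defines "a \<equiv> dist B C" and "b \<equiv> dist C A" and "c \<equiv> dist A B"
  shows "(b + c) *\<^sub>R (D - B) = c *\<^sub>R (C - B)"
    and "(b + c) * dist I D = a * dist I A"
proof -
  obtain u where u: "D = (1 - u) *\<^sub>R B + u *\<^sub>R C"
    using cev by (auto simp: is_cevian_def in_segment)
  obtain m where m: "I = (1 - m) *\<^sub>R A + m *\<^sub>R D"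
    using cev by (auto simp: is_cevian_def in_segment)
  have "(a + b + c) *\<^sub>R (I - A)
      = ((a + b + c) * m * (1 - u)) *\<^sub>R (B - A) + ((a + b + c) * m * u) *\<^sub>R (C - A)"
    unfolding m u by (simp add: algebra_simps)
  then have "((a + b + c) * m * (1 - u)) *\<^sub>R (B - A) + ((a + b + c) * m * u) *\<^sub>R (C - A)
      = b *\<^sub>R (B - A) + c *\<^sub>R (C - A)"
    using incenter_from_vertex(1)[OF nc inc] by (simp add: a_def b_def c_def)
  from noncollinear_coeffs[OF nc this]
  have mu: "(a + b + c) * m * (1 - u) = b" "(a + b + c) * m * u = c" by auto
  \<comment> \<open>Adding the two coefficients eliminates \<open>u\<close>.\<close>
  have Sm: "(a + b + c) * m = b + c"
  proof -
    have "(a + b + c) * m = (a + b + c) * m * (1 - u) + (a + b + c) * m * u"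
      by (simp add: algebra_simps)
    then show ?thesis unfolding mu .
  qed
  then have bu: "(b + c) * u = c" using mu(2) by simp
  have "D - B = u *\<^sub>R (C - B)" unfolding u by (simp add: algebra_simps)
  then show "(b + c) *\<^sub>R (D - B) = c *\<^sub>R (C - B)" using bu by simp
  have ne: "B \<noteq> A" "C \<noteq> A" using nc by (auto simp: insert_commute)
  then have pos: "b > 0" "c > 0" "a \<ge> 0" by (simp_all add: a_def b_def c_def)
  have "(b + c) *\<^sub>R (I - D) = (b + c) *\<^sub>R ((1 - m) *\<^sub>R (A - D))"
    unfolding m by (simp add: algebra_simps)
  also have "\<dots> = a *\<^sub>R (m *\<^sub>R (A - D))"
  proof -
    have "(b + c) * (1 - m) = a * m" using Sm by (simp add: algebra_simps)
    then show ?thesis by simp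
  qed
  also have "m *\<^sub>R (A - D) = A - I" unfolding m by (simp add: algebra_simps)
  finally have "norm ((b + c) *\<^sub>R (I - D)) = norm (a *\<^sub>R (A - I))" by simp
  then show "(b + c) * dist I D = a * dist I A"
    using pos by (simp add: dist_norm norm_minus_commute)
qed

text \<open>Stated for one half triangle only; relabelling the vertices yields the other five. Each
  summand on the right is shared with another of the six, so it can cancel.\<close>

lemma exradius_of_half_cevian:
  assumes nc: "\<not> collinear {A, B, C}" and inc: "is_incircle A B C I \<rho>"
    and cev: "is_cevian A B C I D" and ex: "is_exradius I B D r"
  shows "cos (angle A C B / 2) / r
    = (dist C A + dist A B) / (dist B C * dist I A) + 1 / dist I B - cos (angle A C B / 2) / \<rho>"
proof -
  define a b c where "a = dist B C" and "b = dist C A" and "c = dist A B"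
  define k where "k = cos (angle A C B / 2)"
  define p q where "p = dist I A" and "q = dist I B"
  have ne: "B \<noteq> A" "C \<noteq> A" "B \<noteq> C" using nc by (auto simp: insert_commute)
  then have pos: "a > 0" "b > 0" "c > 0" by (simp_all add: a_def b_def c_def)
  have rho: "\<rho> > 0" using inc by (simp add: is_incircle_def)
  have r: "r > 0" using ex by (auto simp: is_exradius_def is_excircle_def)
  note foot = bisector_foot[OF nc inc cev, folded a_def b_def c_def p_def]
  \<comment> \<open>The touching point on \<open>BC\<close> is the foot of the altitude from
    \<open>I\<close> in the triangle \<open>BID\<close>. It may lie outside the segment
    \<open>BD\<close>, so it is only placed on the line.\<close>
  obtain T where "tangent_at I \<rho> B C T"
    using inc by (auto simp: is_incircle_def touches_side_def)
  note T = tangent_at_facts[OF this]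
  have DB: "D - B = (c / (b + c)) *\<^sub>R (C - B)"
  proof -
    have "D - B = (1 / (b + c)) *\<^sub>R ((b + c) *\<^sub>R (D - B))" using pos by simp
    then show ?thesis unfolding foot(1) by simp
  qed
  then have CB: "C - B = ((b + c) / c) *\<^sub>R (D - B)" using pos by simp
  obtain l where "T = B + l *\<^sub>R (C - B)" using T(3) by blast
  then have TB: "T = B + (l * ((b + c) / c)) *\<^sub>R (D - B)" by (simp add: CB)
  have "dist B D = norm (D - B)" by (simp add: dist_norm norm_minus_commute)
  also have "\<dots> = c * a / (b + c)"
    unfolding DB using pos by (simp add: a_def dist_norm norm_minus_commute)
  finally have BD: "(b + c) * dist B D = c * a" using pos by simp
  have "B \<noteq> D" using BD pos by auto
  moreover have "(I - T) \<bullet> (D - B) = 0" using T(1) by (simp add: DB)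
  moreover have "T \<noteq> I" "dist I T = \<rho>" using T(2) rho by (auto simp: dist_norm)
  ultimately have "r * (q + dist I D - dist B D) = \<rho> * dist B D"
    using exradius_height[OF ex _ TB] by (simp add: q_def)
  \<comment> \<open>Multiplication by \<open>b + c\<close> clears the denominators of
    \<open>BD\<close> and \<open>ID\<close>.\<close>
  then have main: "r * (q * (b + c) + a * p - c * a) = \<rho> * (c * a)"
    using BD foot(2) by algebra
  have area: "p * q * k = c * \<rho>"
    using incenter_area[OF nc inc] by (simp add: p_def q_def k_def c_def)
  have "p * q * k \<noteq> 0" unfolding area using pos rho by simp
  then have nz: "p \<noteq> 0" "q \<noteq> 0" "k \<noteq> 0" by auto
  have "k / r = (b + c) / (a * p) + 1 / q - k / \<rho>"
  proof -
    have "\<rho> / r = (q * (b + c) + a * p - c * a) / (c * a)"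
      using main r pos by (simp add: field_simps)
    then have "\<rho> * (k / r) = k * ((q * (b + c) + a * p - c * a) / (c * a))"
      by (metis mult.commute times_divide_eq_right)
    also have "\<dots> = (q * k / c) * ((b + c) / a) + p * k / c - k"
      using pos by (simp add: field_simps)
    \<comment> \<open>The area identity \<open>p * q * k = c * \<rho>\<close> trades the cosine for
      a reciprocal distance, here and in the next step.\<close>
    also have "q * k / c = \<rho> / p" using area nz pos by (simp add: field_simps)
    also have "p * k / c = \<rho> / q" using area nz pos by (simp add: field_simps)
    finally have "\<rho> * (k / r) = \<rho> * ((b + c) / (a * p) + 1 / q - k / \<rho>)"
      using rho by (simp add: algebra_simps)
    then show ?thesis using rho by (simp only: mult_cancel_left) simp
  qed
  then show ?thesis by (simp add: a_def b_def c_def k_def p_def q_def)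
qed

theorem theorem8p4:
  fixes A B C D E F I :: "real^2"
    and r1 r2 r3 r4 r5 r6 \<alpha> \<beta> \<gamma> :: real
  assumes "\<not> collinear {A, B, C}"
    and "is_incenter A B C I"
    and "is_cevian A B C I D"
    and "is_cevian B C A I E"
    and "is_cevian C A B I F"
    and "is_exradius I B D r1"
    and "is_exradius I D C r2"
    and "is_exradius I C E r3"
    and "is_exradius I E A r4"
    and "is_exradius I A F r5"
    and "is_exradius I F B r6"
    and "\<alpha> = angle B A C / 2"
    and "\<beta> = angle C B A / 2"
    and "\<gamma> = angle A C B / 2"
  shows "cos \<gamma> / r1 + cos \<alpha> / r3 + cos \<beta> / r5 = cos \<beta> / r2 + cos \<gamma> / r4 + cos \<alpha> / r6"
proof -
  obtain \<rho> where inc: "is_incircle A B C I \<rho>" using assms(2) by (auto simp: is_incenter_def)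
  have incs: "is_incircle A C B I \<rho>" "is_incircle B C A I \<rho>" "is_incircle B A C I \<rho>"
    "is_incircle C A B I \<rho>" "is_incircle C B A I \<rho>"
    using inc is_incircle_rotate is_incircle_swap by blast+
  have ncs: "\<not> collinear {A, C, B}" "\<not> collinear {B, C, A}" "\<not> collinear {B, A, C}"
    "\<not> collinear {C, A, B}" "\<not> collinear {C, B, A}"
    using assms(1) by (simp_all add: insert_commute)
  have cevs: "is_cevian A C B I D" "is_cevian B A C I E" "is_cevian C B A I F"
    using assms(3-5) is_cevian_swap by blast+
  have exs: "is_exradius I C D r2" "is_exradius I A E r4" "is_exradius I B F r6"
    using assms(7,9,11) is_exradius_swap by blast+
  \<comment> \<open>The fractions with \<open>IA\<close>, \<open>IB\<close>, \<open>IC\<close> and a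
    side agree within each of the pairs \<open>r1, r2\<close>, \<open>r3, r4\<close>,
    \<open>r5, r6\<close>. The reciprocal distances agree for \<open>r1, r6\<close>,
    \<open>r2, r3\<close>, \<open>r4, r5\<close>, and the cosines over \<open>\<rho>\<close> for
    \<open>r1, r4\<close>, \<open>r3, r6\<close>, \<open>r2, r5\<close>. Each pair has one member on
    either side of the identity.\<close>
  note halves = exradius_of_half_cevian[OF assms(1) inc assms(3) assms(6)]
    exradius_of_half_cevian[OF ncs(1) incs(1) cevs(1) exs(1)]
    exradius_of_half_cevian[OF ncs(2) incs(2) assms(4) assms(8)]
    exradius_of_half_cevian[OF ncs(3) incs(3) cevs(2) exs(2)]
    exradius_of_half_cevian[OF ncs(4) incs(4) assms(5) assms(10)]
    exradius_of_half_cevian[OF ncs(5) incs(5) cevs(3) exs(3)]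
  show ?thesis
    unfolding assms(12-14)
    using halves
    by (simp add: angle_swap[of A B C] angle_swap[of B C A] angle_swap[of C A B]
        dist_commute[of B A] dist_commute[of C A] dist_commute[of C B] add.commute)
qed

end
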